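(* Let $q$ be a prime power, $r\ge 1$, and let $\tau$ be a permutation of the vectors of $F_q^r$ with $\tau({\bf 0})={\bf 0}$ and distension $l$. Then the rank (dimension of the $F_q$-linear span) of the code $S_\tau=\bigcup_{a\in F_q^r}C_a\times D_{\tau(a)}$ of length $\frac{q^{r+1}-1}{q-1}$ is equal to $\frac{q^{r+1}-1}{q-1}-r-1+l$.
   Context: Let $n=\frac{q^r-1}{q-1}$. Let $H_C$ be an $r\times n$ matrix over $F_q$ whose columns are representatives of the $n$ distinct one-dimensional subspaces of $F_q^r$, $C=\{x\in F_q^n: H_Cx^T={\bf 0}\}$, and for $a\in F_q^r$, $C_a=\{x\in F_q^n: H_Cx^T=a\}$. Let $D$ be the linear code of length $q^r$ with coordinate positions indexed by vectors of $F_q^r$, $D=\{y=(y_a)_{a\in F_q^r}: \sum_a y_a=0,\ \sum_a y_a a={\bf 0}\}$ (parity check matrix with column $\binom{1}{a}$ at position $a$). $e_a$ is the length-$q^r$ unit vector at position $a$, $D_a=D+e_{\bf 0}-e_a$, and $X\times Y=\{(x|y):x\in X, y\in Y\}$ with $|$ denoting concatenation. A permutation $\tau$ of $F_q^r$ acts on vectors of length $q^r$ by permuting positions, $\tau(e_a)=e_{\tau(a)}$ extended linearly; the distension of $\tau$ is $\dim D-\dim(D\cap\tau(D))$, where $\tau(D)=\{\tau(y):y\in D\}$. *)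

theory Defs
  imports "HOL-Analysis.Analysis"
begin

text \<open>
  \<open>F\<^sub>q\<close> is an arbitrary type \<open>'a\<close> of class field and finite, with \<open>q = CARD('a)\<close>, and
  \<open>F\<^sub>q\<^sup>r\<close> is \<open>'a ^ 'r\<close> with \<open>r = CARD('r)\<close>. Vectors of length \<open>q\<^sup>r\<close> with positions indexed
  by \<open>F\<^sub>q\<^sup>r\<close> have type \<open>'a ^ ('a ^ 'r)\<close>. Linear notions are those of the interpretation
  \<open>vec\<close>, i.e. over the scalar field \<open>'a\<close> with scalar multiplication \<open>*s\<close>.
\<close>

definition projective_columns :: "('a::field) ^ 'n ^ 'r \<Rightarrow> bool" where
  "projective_columns H \<longleftrightarrow>
     bij_betw (\<lambda>j. vec.span {column j H}) UNIV {V. vec.subspace V \<and> vec.dim V = 1}"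

definition codeC :: "('a::field) ^ 'n ^ 'r \<Rightarrow> 'a ^ 'r \<Rightarrow> ('a ^ 'n) set" where
  "codeC H a = {x. H *v x = a}"

definition codeD :: "(('a::{field,finite}) ^ ('a ^ 'r)) set" where
  "codeD = {y. (\<Sum>a\<in>UNIV. y $ a) = 0 \<and> (\<Sum>a\<in>UNIV. (y $ a) *s a) = 0}"

definition unit_vec :: "'i \<Rightarrow> ('a::field) ^ 'i" where
  "unit_vec a = axis a 1"

definition codeD_shift :: "('a::{field,finite}) ^ 'r \<Rightarrow> ('a ^ ('a ^ 'r)) set" where
  "codeD_shift a = {y + unit_vec 0 - unit_vec a | y. y \<in> codeD}"

definition vconcat :: "'a ^ 'm \<Rightarrow> 'a ^ 'k \<Rightarrow> 'a ^ ('m + 'k)" where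
  "vconcat x y = (\<chi> i. case i of Inl j \<Rightarrow> x $ j | Inr b \<Rightarrow> y $ b)"

definition code_prod :: "('a ^ 'm) set \<Rightarrow> ('a ^ 'k) set \<Rightarrow> ('a ^ ('m + 'k)) set" where
  "code_prod X Y = {vconcat x y | x y. x \<in> X \<and> y \<in> Y}"

definition perm_act :: "('i \<Rightarrow> 'i) \<Rightarrow> ('a::field) ^ 'i \<Rightarrow> 'a ^ 'i" where
  "perm_act \<tau> y = (\<Sum>a\<in>UNIV. (y $ a) *s unit_vec (\<tau> a))"

text \<open>The subtraction does not truncate, because \<open>codeD \<inter> perm_act \<tau> ` codeD \<subseteq> codeD\<close>.\<close>

definition distension :: "(('a::{field,finite}) ^ 'r \<Rightarrow> 'a ^ 'r) \<Rightarrow> nat" where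
  "distension \<tau> =
     vec.dim (codeD :: ('a ^ ('a ^ 'r)) set) - vec.dim (codeD \<inter> perm_act \<tau> ` codeD)"

definition code_rank :: "(('a::field) ^ 'i) set \<Rightarrow> nat" where
  "code_rank S = vec.dim (vec.span S)"

definition codeS ::
  "('a::{field,finite}) ^ 'n ^ 'r \<Rightarrow> ('a ^ 'r \<Rightarrow> 'a ^ 'r) \<Rightarrow> ('a ^ ('n + 'a ^ 'r)) set" where
  "codeS H \<tau> = (\<Union>a. code_prod (codeC H a) (codeD_shift (\<tau> a)))"

end

theory Submission
  imports Defs
begin

text \<open>
  Project the span of \<open>S\<^sub>\<tau>\<close> onto its first block of coordinates. The image is all of
  \<open>F\<^sub>q\<^sup>n\<close>, since the sets \<open>C\<^sub>a\<close> cover it. The kernel is \<open>0 \<times> (D + \<tau>(D))\<close>: if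
  \<open>\<Sum> z\<^sub>a = 0\<close> and \<open>x\<^sub>a \<in> C\<^sub>a\<close>, then
  \<open>\<Sum> z\<^sub>a (x\<^sub>a | e\<^sub>0 - e\<^bsub>\<tau>(a)\<^esub>) = (\<Sum> z\<^sub>a x\<^sub>a | -\<tau>(z))\<close>, and the first block lies in \<open>C\<close>
  exactly when \<open>z \<in> D\<close>. Hence the rank is
  \<open>n + dim (D + \<tau>(D)) = n + 2 dim D - dim (D \<inter> \<tau>(D)) = n + dim D + l\<close>, where
  \<open>dim D = q\<^sup>r - r - 1\<close>.
\<close>

section \<open>Rank-nullity on a subspace\<close>

lemma vec_rank_nullity:
  fixes f :: "'a::field ^ 'm \<Rightarrow> 'a ^ 'k"
  assumes f: "Vector_Spaces.linear (*s) (*s) f" and S: "vec.subspace S"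
  shows "vec.dim S = vec.dim (f ` S) + vec.dim {x \<in> S. f x = 0}"
proof -
  interpret f: Vector_Spaces.linear "(*s)" "(*s)" f by (fact f)
  let ?K = "{x \<in> S. f x = 0}"
  have K: "vec.subspace ?K"
    using S by (auto simp: vec.subspace_def f.add f.scale)
  obtain A where A: "A \<subseteq> ?K" "vec.independent A" "vec.span A = ?K" "card A = vec.dim ?K"
    by (rule vec.basis_subspace_exists[OF K])
  obtain B where B: "A \<subseteq> B" "B \<subseteq> S" "vec.independent B" "S \<subseteq> vec.span B"
    using vec.maximal_independent_subset_extend[of A S] A by blast
  have finB: "finite B"
    using B(3) vec.finiteI_independent by blast
  have spB: "vec.span B = S"
    using B S by (simp add: vec.span_subspace)
  let ?C = "vec.span (B - A)"
  have CS: "?C \<subseteq> S"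
    using spB vec.span_mono[of "B - A" B] by auto
  have zero: "x = 0" if "x \<in> ?C" "f x = 0" for x
  proof -
    have xA: "x \<in> vec.span A"
      using that CS A(3) by auto
    \<comment> \<open>As \<open>x\<close> lies in the spans of both \<open>A\<close> and
      \<open>B - A\<close>, a nonzero coordinate over \<open>B\<close> would have to sit at an
      element of both sets.\<close>
    have "vec.representation B x b = 0" for b
      using vec.representation_extend[OF B(3) xA B(1)]
        vec.representation_extend[OF B(3) that(1) Diff_subset]
      by (metis DiffD2 vec.representation_ne_zero)
    then show "x = 0"
      using vec.sum_nonzero_representation_eq[OF B(3), of x] that CS spB by auto
  qed
  have inj: "inj_on f ?C"
    by (rule inj_onI) (metis zero f.diff right_minus_eq vec.span_diff)
  have "f ` S = f ` ?C"
  proof (intro equalityI subsetI)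
    fix y assume "y \<in> f ` S"
    then obtain x where x: "x \<in> vec.span ((B - A) \<union> A)" "y = f x"
      using spB B(1) by (auto simp: Un_absorb2)
    then obtain u v where "u \<in> ?C" "v \<in> vec.span A" "x = u + v"
      unfolding vec.span_Un by auto
    then have "f x = f u"
      using A(3) by (auto simp: f.add)
    then show "y \<in> f ` ?C"
      using x \<open>u \<in> ?C\<close> by auto
  qed (use CS in auto)
  then have "vec.dim (f ` S) = vec.dim ?C"
    using vec.dim_image_eq[OF f] inj by (simp add: vec.span_span)
  also have "\<dots> = card (B - A)"
    using B(3) by (metis Diff_subset vec.dim_span vec.dim_eq_card_independent vec.independent_mono)
  finally show ?thesis
    using A B finB spB by (metis card_Diff_subset card_mono finite_subset le_add_diff_inverse2
        vec.dim_span_eq_card_independent)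
qed

lemma vec_linearI:
  fixes f :: "'a::field ^ 'm \<Rightarrow> 'a ^ 'k"
  assumes "\<And>x y. f (x + y) = f x + f y" and "\<And>c x. f (c *s x) = c *s f x"
  shows "Vector_Spaces.linear (*s) (*s) f"
  by unfold_locales (fact assms)+

section \<open>The code D and its dimension\<close>

text \<open>The parity check matrix of \<open>D\<close>; the component \<open>None\<close> is its all-ones row.\<close>

definition syndrome :: "('a::{field,finite}) ^ ('a ^ 'r) \<Rightarrow> 'a ^ ('r option)" where
  "syndrome y = (\<chi> i. case i of None \<Rightarrow> \<Sum>a\<in>UNIV. y $ a | Some j \<Rightarrow> (\<Sum>a\<in>UNIV. y $ a *s a) $ j)"

lemma linear_syndrome: "Vector_Spaces.linear (*s) (*s) syndrome"
  by (rule vec_linearI)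
    (auto simp: syndrome_def vec_eq_iff sum.distrib sum_distrib_left algebra_simps split: option.split)

lemma syndrome_eq_0_iff: "syndrome y = 0 \<longleftrightarrow> y \<in> codeD"
  by (auto simp: syndrome_def codeD_def vec_eq_iff split: option.split)

lemma subspace_codeD: "vec.subspace codeD"
  using vec.linear_subspace_kernel[OF linear_syndrome] by (simp add: syndrome_eq_0_iff)

lemma sum_unit_vec: "(\<Sum>b\<in>UNIV. unit_vec a $ b) = 1"
  by (simp add: unit_vec_def axis_def)

lemma sum_unit_vec_scale: "(\<Sum>b\<in>UNIV. unit_vec a $ b *s f b) = f a"
  by (simp add: unit_vec_def axis_def if_distrib[of "\<lambda>c. c *s _"] cong: if_cong)

lemma range_syndrome: "range (syndrome :: ('a::{field,finite}) ^ ('a ^ 'r) \<Rightarrow> _) = UNIV"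
proof (intro equalityI subsetI)
  fix w :: "'a ^ ('r option)"
  let ?a = "\<chi> j. w $ Some j"
  \<comment> \<open>The unit vector at \<open>?a\<close> yields the right weighted sum but
    contributes 1 to the plain sum; position 0 has weight zero, so its coefficient can correct the
    plain sum freely.\<close>
  let ?y = "(w $ None - 1) *s unit_vec 0 + unit_vec ?a :: 'a ^ ('a ^ 'r)"
  have "(\<Sum>a\<in>UNIV. ?y $ a) = w $ None"
    by (simp add: sum.distrib sum_unit_vec left_diff_distrib sum_subtractf flip: sum_distrib_left)
  moreover have "(\<Sum>a\<in>UNIV. ?y $ a *s a) = ?a"
    by (simp only: vector_add_component vector_smult_component vec.scale_left_distrib sum.distrib
        sum_unit_vec_scale[of _ "\<lambda>a. a"] vec.scale_zero_right add_0
        flip: vec.scale_scale vec.scale_sum_right)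
  ultimately have "syndrome ?y = w"
    by (auto simp: syndrome_def vec_eq_iff split: option.split)
  then show "w \<in> range syndrome"
    by (metis rangeI)
qed simp

text \<open>The parity check matrix has full rank \<open>r + 1\<close> by
  \<open>range_syndrome\<close>, and D is its kernel in a space of dimension \<open>q^r\<close>. The
  additive form avoids truncated subtraction.\<close>

lemma dim_codeD:
  "vec.dim (codeD :: ('a::{field,finite} ^ ('a ^ 'r)) set) + CARD('r) + 1 = CARD('a) ^ CARD('r)"
  using vec_rank_nullity[where f = "syndrome :: 'a ^ ('a ^ 'r) \<Rightarrow> _",
      OF linear_syndrome vec.subspace_UNIV]
  by (simp add: range_syndrome syndrome_eq_0_iff vec_dim_card del: vec.dim_UNIV)

section \<open>The permuted code and the distension\<close>

lemma linear_perm_act: "Vector_Spaces.linear (*s) (*s) (perm_act \<tau>)"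
  by (rule vec_linearI)
    (simp_all add: perm_act_def vec.scale_left_distrib sum.distrib vec.scale_sum_right)

lemma perm_act_unit_vec: "perm_act \<tau> (unit_vec a) = unit_vec (\<tau> a)"
  by (simp add: perm_act_def sum_unit_vec_scale)

lemma inj_perm_act:
  fixes \<tau> :: "'i::finite \<Rightarrow> 'i"
  assumes "inj \<tau>"
  shows "inj (perm_act \<tau> :: 'a::field ^ 'i \<Rightarrow> _)"
proof (rule injI)
  fix x y :: "'a ^ 'i" assume "perm_act \<tau> x = perm_act \<tau> y"
  moreover have "perm_act \<tau> z $ \<tau> a = z $ a" for z :: "'a ^ 'i" and a
    using assms by (simp add: perm_act_def unit_vec_def axis_def inj_eq if_distrib cong: if_cong)
  ultimately show "x = y"
    by (metis vec_eq_iff)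
qed

text \<open>Rank-nullity for \<open>syndrome\<close> is applied twice: its kernel is
  \<open>D\<close> on \<open>D + T\<close> and \<open>D \<inter> T\<close> on \<open>T\<close>,
  where \<open>T\<close> is the permuted code. Both images agree because \<open>syndrome\<close>
  kills \<open>D\<close>, and \<open>dim T = dim D\<close>, so the gain over \<open>dim D\<close> is
  exactly the distension.\<close>

lemma dim_codeD_sum_perm_act:
  fixes \<tau> :: "('a::{field,finite}) ^ 'r \<Rightarrow> 'a ^ 'r"
  assumes "bij \<tau>"
  shows "vec.dim {d + t | d t. d \<in> codeD \<and> t \<in> perm_act \<tau> ` codeD}
    = vec.dim (codeD :: ('a ^ ('a ^ 'r)) set) + distension \<tau>"
proof -
  interpret s: Vector_Spaces.linear "(*s)" "(*s)" "syndrome :: 'a ^ ('a ^ 'r) \<Rightarrow> _"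
    by (rule linear_syndrome)
  let ?D = "codeD :: ('a ^ ('a ^ 'r)) set"
  let ?T = "perm_act \<tau> ` ?D"
  let ?U = "{d + t | d t. d \<in> ?D \<and> t \<in> ?T}"
  have T: "vec.subspace ?T"
    using vec.linear_subspace_image[OF linear_perm_act subspace_codeD] .
  have U: "vec.subspace ?U"
    using vec.subspace_sums[OF subspace_codeD T] .
  have "{x \<in> ?U. syndrome x = 0} = ?D"
    using vec.subspace_0[OF T] by (force simp: syndrome_eq_0_iff)
  moreover have "syndrome ` ?U = syndrome ` ?T"
  proof (intro equalityI subsetI)
    fix w assume "w \<in> syndrome ` ?U"
    then show "w \<in> syndrome ` ?T"
      by (auto simp: s.add syndrome_eq_0_iff[THEN iffD2])
  next
    fix w assume "w \<in> syndrome ` ?T"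
    moreover have "?T \<subseteq> ?U"
      using vec.subspace_0[OF subspace_codeD] by force
    ultimately show "w \<in> syndrome ` ?U"
      by blast
  qed
  ultimately have "vec.dim ?U = vec.dim (syndrome ` ?T) + vec.dim ?D"
    using vec_rank_nullity[OF linear_syndrome U] by simp
  moreover have "{x \<in> ?T. syndrome x = 0} = ?D \<inter> ?T"
    by (auto simp: syndrome_eq_0_iff)
  then have "vec.dim ?T = vec.dim (syndrome ` ?T) + vec.dim (?D \<inter> ?T)"
    using vec_rank_nullity[OF linear_syndrome T] by simp
  moreover have "vec.dim ?T = vec.dim ?D"
    using vec.dim_image_eq[OF linear_perm_act] inj_perm_act[of \<tau>] assms
    by (metis bij_is_inj inj_on_subset subset_UNIV)
  ultimately show ?thesis
    unfolding distension_def by simp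
qed

text \<open>The line through a nonzero \<open>a\<close> is spanned by some column \<open>j\<close>,
  so \<open>a\<close> is the image of a multiple of the unit vector at \<open>j\<close>.\<close>

lemma surj_if_projective_columns:
  fixes H :: "('a::field) ^ 'n ^ 'r"
  assumes "projective_columns H"
  shows "surj ((*v) H)"
proof -
  have "\<exists>x. H *v x = a" for a
  proof (cases "a = 0")
    case False
    then have "vec.span {a} \<in> {V. vec.subspace V \<and> vec.dim V = 1}"
      by simp
    then obtain j where "vec.span {a} = vec.span {column j H}"
      using assms unfolding projective_columns_def bij_betw_def by (metis (no_types, lifting) imageE)
    then obtain c where "a = c *s column j H"
      using vec.span_base[of a "{a}"] by (auto simp: vec.span_singleton)
    then have "H *v (c *s axis j 1) = a"
      by (simp add: vector_scalar_commute matrix_vector_mul_component column_def vec_eq_iff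
          matrix_vector_mult_def axis_def if_distrib cong: if_cong)
    then show ?thesis ..
  qed (auto intro: exI[of _ 0])
  then show ?thesis
    by (metis surjI)
qed

section \<open>Concatenation and projection to the first block\<close>

lemma vconcat_add: "vconcat x y + vconcat x' y' = vconcat (x + x') (y + y')"
  by (simp add: vconcat_def vec_eq_iff split: sum.split)

lemma vconcat_diff: "vconcat x y - vconcat x' y' = vconcat (x - x') (y - y')"
  for x x' :: "'a::ab_group_add ^ 'm"
  by (simp add: vconcat_def vec_eq_iff split: sum.split)

lemma vconcat_scale: "c *s vconcat x y = vconcat (c *s x) (c *s y)"
  by (simp add: vconcat_def vec_eq_iff split: sum.split)

lemma vconcat_0: "vconcat 0 0 = 0"
  by (simp add: vconcat_def vec_eq_iff split: sum.split)

lemma vconcat_sum: "(\<Sum>i\<in>I. vconcat (f i) (g i)) = vconcat (\<Sum>i\<in>I. f i) (\<Sum>i\<in>I. g i)"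
  by (induction I rule: infinite_finite_induct) (simp_all add: vconcat_0 vconcat_add)

lemma vconcat_eq_iff [simp]: "vconcat x y = vconcat x' y' \<longleftrightarrow> x = x' \<and> y = y'"
  by (simp add: vconcat_def vec_eq_iff split_sum_all)

definition vleft :: "'a ^ ('m::finite + 'k::finite) \<Rightarrow> 'a ^ 'm" where
  "vleft v = (\<chi> i. v $ Inl i)"

lemma vleft_vconcat [simp]: "vleft (vconcat x y) = x"
  by (simp add: vleft_def vconcat_def vec_eq_iff)

lemma linear_vleft: "Vector_Spaces.linear (*s) (*s) vleft"
  by (rule vec_linearI) (simp_all add: vleft_def vec_eq_iff)

section \<open>The span of the code and its kernel part\<close>

lemma codeS_memI:
  assumes "H *v x = a" and "d \<in> codeD"
  shows "vconcat x (d + unit_vec 0 - unit_vec (\<tau> a)) \<in> codeS H \<tau>"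
  using assms unfolding codeS_def code_prod_def codeC_def codeD_shift_def by blast

text \<open>This is the upper bound for the kernel. The vector \<open>z\<close> collects the
  coefficients of the words combined; its conditions are linear in \<open>x\<close> and
  \<open>z\<close>, so the right-hand side is a subspace and only the words of \<open>codeS\<close>
  need checking.\<close>

lemma span_codeS_subset:
  fixes H :: "('a::{field,finite}) ^ 'n ^ 'r"
  assumes "\<tau> 0 = 0"
  shows "vec.span (codeS H \<tau>) \<subseteq> {vconcat x (d - perm_act \<tau> z) | x d z.
    d \<in> codeD \<and> (\<Sum>a\<in>UNIV. z $ a) = 0 \<and> H *v x = (\<Sum>a\<in>UNIV. z $ a *s a)}" (is "_ \<subseteq> ?E")
proof (rule vec.span_minimal)
  interpret p: Vector_Spaces.linear "(*s)" "(*s)" "perm_act \<tau> :: 'a ^ ('a ^ 'r) \<Rightarrow> _"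
    by (rule linear_perm_act)
  show "codeS H \<tau> \<subseteq> ?E"
  proof
    fix v assume "v \<in> codeS H \<tau>"
    then obtain x d a where v: "v = vconcat x (d + unit_vec 0 - unit_vec (\<tau> a))"
      "H *v x = a" "d \<in> codeD"
      unfolding codeS_def code_prod_def codeC_def codeD_shift_def by blast
    \<comment> \<open>Subtracting the unit vector at 0 makes the plain sum vanish and leaves the
      weighted sum at \<open>a\<close>; \<open>perm_act \<tau>\<close> fixes it since
      \<open>\<tau> 0 = 0\<close>.\<close>
    let ?z = "unit_vec a - unit_vec 0 :: 'a ^ ('a ^ 'r)"
    have "(\<Sum>b\<in>UNIV. ?z $ b) = 0"
      by (simp add: sum_subtractf sum_unit_vec)
    moreover have "(\<Sum>b\<in>UNIV. ?z $ b *s b) = a"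
      by (simp add: sum_unit_vec_scale[of _ "\<lambda>a. a"] vec.scale_left_diff_distrib sum_subtractf)
    moreover have "d + unit_vec 0 - unit_vec (\<tau> a) = d - perm_act \<tau> ?z"
      by (simp add: p.diff perm_act_unit_vec assms)
    ultimately show "v \<in> ?E"
      using v by (intro CollectI exI[of _ x] exI[of _ d] exI[of _ ?z] conjI) (simp_all only:)
  qed
  show "vec.subspace ?E"
    unfolding vec.subspace_def
  proof (intro conjI ballI allI)
    show "0 \<in> ?E"
      using vec.subspace_0[OF subspace_codeD]
      by (auto simp: p.zero intro!: exI[of _ 0] simp flip: vconcat_0)
  next
    fix u v assume "u \<in> ?E" "v \<in> ?E"
    then obtain x d z x' d' z' where
      "u = vconcat x (d - perm_act \<tau> z)" "d \<in> codeD" "(\<Sum>a\<in>UNIV. z $ a) = 0"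
      "H *v x = (\<Sum>a\<in>UNIV. z $ a *s a)"
      "v = vconcat x' (d' - perm_act \<tau> z')" "d' \<in> codeD" "(\<Sum>a\<in>UNIV. z' $ a) = 0"
      "H *v x' = (\<Sum>a\<in>UNIV. z' $ a *s a)"
      by blast
    then show "u + v \<in> ?E"
      by (intro CollectI exI[of _ "x + x'"] exI[of _ "d + d'"] exI[of _ "z + z'"])
        (simp add: vconcat_add p.add sum.distrib vec.scale_left_distrib vec.add
          vec.subspace_add[OF subspace_codeD])
  next
    fix c u assume "u \<in> ?E"
    then obtain x d z where
      "u = vconcat x (d - perm_act \<tau> z)" "d \<in> codeD" "(\<Sum>a\<in>UNIV. z $ a) = 0"
      "H *v x = (\<Sum>a\<in>UNIV. z $ a *s a)"
      by blast
    moreover have "(\<Sum>a\<in>UNIV. (c *s z) $ a) = c * (\<Sum>a\<in>UNIV. z $ a)"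
      by (simp add: sum_distrib_left)
    moreover have "(\<Sum>a\<in>UNIV. (c *s z) $ a *s a) = c *s (\<Sum>a\<in>UNIV. z $ a *s a)"
      by (simp add: vec.scale_sum_right)
    ultimately show "c *s u \<in> ?E"
      by (intro CollectI exI[of _ "c *s x"] exI[of _ "c *s d"] exI[of _ "c *s z"])
        (simp add: vconcat_scale p.scale vec.scale vec.scale_right_diff_distrib
          vec.subspace_scale[OF subspace_codeD] del: vector_smult_component)
  qed
qed

lemma span_codeS_kernel:
  assumes "surj ((*v) H)" and "\<tau> 0 = 0"
  shows "{v \<in> vec.span (codeS H \<tau>). vleft v = 0}
    = vconcat 0 ` {d + t | d t. d \<in> codeD \<and> t \<in> perm_act \<tau> ` codeD}" (is "?K = ?R")
proof (intro equalityI subsetI)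
  interpret p: Vector_Spaces.linear "(*s)" "(*s)" "perm_act \<tau>"
    by (rule linear_perm_act)
  fix v assume "v \<in> ?K"
  then obtain d z where v: "v = vconcat 0 (d - perm_act \<tau> z)" and "d \<in> codeD"
    and z: "(\<Sum>a\<in>UNIV. z $ a) = 0" "(\<Sum>a\<in>UNIV. z $ a *s a) = 0"
    using span_codeS_subset[where \<tau> = \<tau> and H = H, OF assms(2)]
    by (auto simp: matrix_vector_mult_0_right)
  \<comment> \<open>With first block 0, the condition on \<open>H *v x\<close> says that the
    weighted sum of \<open>z\<close> vanishes, which puts \<open>z\<close> into D.\<close>
  moreover have "- z \<in> codeD"
    using z by (intro vec.subspace_neg[OF subspace_codeD]) (simp add: codeD_def)
  moreover have "d - perm_act \<tau> z = d + perm_act \<tau> (- z)"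
    by (simp add: p.neg)
  ultimately show "v \<in> ?R"
    by blast
next
  let ?S = "vec.span (codeS H \<tau>)"
  fix v assume "v \<in> ?R"
  then obtain d z where v: "v = vconcat 0 (d + perm_act \<tau> z)" and d: "d \<in> codeD"
    and z: "(\<Sum>a\<in>UNIV. z $ a) = 0" "(\<Sum>a\<in>UNIV. z $ a *s a) = 0"
    by (auto simp: codeD_def)
  \<comment> \<open>The member \<open>a = 0\<close> of the union is \<open>C \<times> D\<close>,
    because \<open>\<tau> 0 = 0\<close> and the shift at 0 is trivial.\<close>
  have CD: "vconcat x d \<in> ?S" if "H *v x = 0" "d \<in> codeD" for x d
    using codeS_memI[where \<tau> = \<tau>, OF that] assms(2) by (simp add: vec.span_base)
  obtain x where x: "\<And>a. H *v x a = a"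
    using assms(1) by (metis surjD)
  let ?w = "\<Sum>a\<in>UNIV. z $ a *s vconcat (x a) (unit_vec 0 - unit_vec (\<tau> a))"
  have "vconcat (x a) (unit_vec 0 - unit_vec (\<tau> a)) \<in> ?S" for a
    using codeS_memI[where \<tau> = \<tau>, OF x[of a] vec.subspace_0[OF subspace_codeD]]
    by (simp add: vec.span_base)
  then have w: "?w \<in> ?S"
    by (intro vec.span_sum vec.span_scale)
  \<comment> \<open>The terms at position 0 cancel because the entries of \<open>z\<close> sum to
    0.\<close>
  have "?w = vconcat (\<Sum>a\<in>UNIV. z $ a *s x a) (- perm_act \<tau> z)"
    using z(1) by (simp add: vconcat_scale vconcat_sum perm_act_def vec.scale_right_diff_distrib
        sum_subtractf flip: vec.scale_sum_left)
  moreover have "H *v (\<Sum>a\<in>UNIV. z $ a *s x a) = 0"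
    using z(2) by (simp add: vec.sum vec.scale x)
  then have "vconcat (\<Sum>a\<in>UNIV. z $ a *s x a) d \<in> ?S"
    using CD d by blast
  \<comment> \<open>Subtracting \<open>?w\<close> clears the first block and turns
    \<open>- perm_act \<tau> z\<close> into a positive summand.\<close>
  ultimately have "vconcat 0 (d + perm_act \<tau> z) \<in> ?S"
    using vec.span_diff[OF _ w] by (fastforce simp: vconcat_diff)
  then show "v \<in> ?K"
    by (simp add: v)
qed

lemma vleft_span_codeS:
  fixes H :: "('a::{field,finite}) ^ 'n ^ 'r"
  shows "vleft ` vec.span (codeS H \<tau>) = UNIV"
proof (intro equalityI subsetI)
  fix x :: "'a ^ 'n"
  show "x \<in> vleft ` vec.span (codeS H \<tau>)"
    using vec.span_base[OF codeS_memI[where H = H and x = x, OF refl vec.subspace_0[OF subspace_codeD]]]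
    by (metis image_eqI vleft_vconcat)
qed simp

section \<open>Rank and length\<close>

lemma code_rank_codeS:
  fixes H :: "('a::{field,finite}) ^ 'n ^ 'r"
  assumes "surj ((*v) H)" and "bij \<tau>" and "\<tau> 0 = 0"
  shows "code_rank (codeS H \<tau>) + CARD('r) + 1 = CARD('n) + CARD('a) ^ CARD('r) + distension \<tau>"
proof -
  let ?U = "{d + t | d t. d \<in> codeD \<and> t \<in> perm_act \<tau> ` codeD}"
  have "Vector_Spaces.linear (*s) (*s) (vconcat (0 :: 'a ^ 'n) :: 'a ^ ('a ^ 'r) \<Rightarrow> _)"
    by (rule vec_linearI) (simp_all add: vconcat_add vconcat_scale)
  then have "vec.dim (vconcat (0 :: 'a ^ 'n) ` ?U) = vec.dim ?U"
    by (rule vec.dim_image_eq) (simp add: inj_on_def)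
  then have "code_rank (codeS H \<tau>) = CARD('n) + vec.dim ?U"
    using vec_rank_nullity[OF linear_vleft vec.subspace_span, of "codeS H \<tau>"]
    unfolding code_rank_def span_codeS_kernel[where \<tau> = \<tau>, OF assms(1,3)] vleft_span_codeS
    by (simp add: vec_dim_card del: vec.dim_UNIV)
  then show ?thesis
    using dim_codeD_sum_perm_act[OF assms(2)] dim_codeD[where 'a = 'a and 'r = 'r] by simp
qed

text \<open>Identifies the length \<open>n + q^r\<close> through
  \<open>q^(r+1) - 1 = (q^r - 1) + (q - 1) q^r\<close>; \<open>q \<ge> 2\<close> makes the divisor
  nonzero.\<close>

lemma repunit_Suc:
  fixes q :: nat
  assumes "q \<ge> 2"
  shows "(q ^ (r + 1) - 1) div (q - 1) = (q ^ r - 1) div (q - 1) + q ^ r"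
proof -
  have "1 \<le> q ^ r" "q \<ge> 1"
    using assms by simp_all
  then have "q ^ (r + 1) - 1 = (q ^ r - 1) + (q - 1) * q ^ r"
    by (simp add: diff_mult_distrib)
  then show ?thesis
    using assms by (simp only: div_mult_self2)
qed

theorem theorem3:
  fixes H :: "('a::{field,finite}) ^ 'n ^ 'r"
    and \<tau> :: "'a ^ 'r \<Rightarrow> 'a ^ 'r"
    and q r l :: nat
  assumes "q = CARD('a)" and "r = CARD('r)"
    and "CARD('n) = (q ^ r - 1) div (q - 1)"
    and "projective_columns H"
    and "bij \<tau>" and "\<tau> 0 = 0"
    and "distension \<tau> = l"
  shows "CARD('n + 'a ^ 'r) = (q ^ (r + 1) - 1) div (q - 1) \<and>
    int (code_rank (codeS H \<tau>)) = (int q ^ (r + 1) - 1) div (int q - 1) - int r - 1 + int l"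
proof
  \<comment> \<open>A field contains the distinct elements 0 and 1.\<close>
  have q: "q \<ge> 2"
    using card_mono[of UNIV "{0, 1 :: 'a}"] assms(1) by simp
  then have N: "CARD('n) + q ^ r = (q ^ (r + 1) - 1) div (q - 1)"
    using repunit_Suc assms(3) by simp
  then show "CARD('n + 'a ^ 'r) = (q ^ (r + 1) - 1) div (q - 1)"
    by (simp add: assms(1,2))
  \<comment> \<open>Since \<open>q \<ge> 2\<close>, neither natural subtraction truncates, so the
    integer and natural quotients agree.\<close>
  have "(int q ^ (r + 1) - 1) div (int q - 1) = int ((q ^ (r + 1) - 1) div (q - 1))"
    using q by (simp add: zdiv_int of_nat_diff)
  then show "int (code_rank (codeS H \<tau>)) = (int q ^ (r + 1) - 1) div (int q - 1) - int r - 1 + int l"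
    using code_rank_codeS[OF surj_if_projective_columns[OF assms(4)] assms(5,6)] N assms(1,2,7)
    by simp
qed

end
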